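(* Let $m\ge 1$ be an integer and $0<p<1$. Let $X_1,X_2,\dots$ be i.i.d. random letters with $\mathbb{P}(X_1=\alpha_i)=\frac{1-p}{m}$ for $i=1,\dots,m$ and $\mathbb{P}(X_1=\alpha_{m+1})=p$, and let $Y_1,Y_2,\dots$ be i.i.d. random letters, independent of $(X_i)_{i\ge 1}$, with $\mathbb{P}(Y_1=\alpha_i)=\frac1m$ for $i=1,\dots,m$. Let $LC_n$ be the length of the longest common subsequences of $X_1\cdots X_n$ and $Y_1\cdots Y_n$. Then for all $n\in\mathbb{N}$, $$\operatorname{Var} LC_n\ \le\ \frac n2\left(2-p^2-\frac{1+(1-p)^2}{m}\right).$$
   Context: The alphabet is $\{\alpha_1,\dots,\alpha_m,\alpha_{m+1}\}$, with $m+1$ distinct letters. $LC_n$ is the largest $k$ such that there exist $1\le i_1<\cdots<i_k\le n$ and $1\le j_1<\cdots<j_k\le n$ with $X_{i_s}=Y_{j_s}$ for $s=1,\dots,k$ (and $LC_n=0$ if no such $k\ge 1$ exists). *)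

theory Defs
  imports "HOL-Probability.Probability"
begin

text \<open>Sequences are indexed by the positive integers; the value at \<open>0\<close> is irrelevant throughout.\<close>

definition (in prob_space) iid_seq :: "'b measure \<Rightarrow> (nat \<Rightarrow> 'a \<Rightarrow> 'b) \<Rightarrow> bool" where
  "iid_seq N Z \<longleftrightarrow>
     indep_vars (\<lambda>_. N) Z {1..} \<and>
     (\<forall>k\<ge>1. distr M N (Z k) = distr M N (Z 1))"

definition (in prob_space) indep_seqs ::
  "'b measure \<Rightarrow> (nat \<Rightarrow> 'a \<Rightarrow> 'b) \<Rightarrow> (nat \<Rightarrow> 'a \<Rightarrow> 'b) \<Rightarrow> bool" where
  "indep_seqs N Z W \<longleftrightarrow>
     indep_var (PiM {1..} (\<lambda>_. N)) (\<lambda>\<omega>. \<lambda>k\<in>{1..}. Z k \<omega>)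
               (PiM {1..} (\<lambda>_. N)) (\<lambda>\<omega>. \<lambda>k\<in>{1..}. W k \<omega>)"

definition has_common_subseq :: "nat \<Rightarrow> (nat \<Rightarrow> 'b) \<Rightarrow> (nat \<Rightarrow> 'b) \<Rightarrow> nat \<Rightarrow> bool" where
  "has_common_subseq n x y k \<longleftrightarrow>
     (\<exists>i j :: nat \<Rightarrow> nat.
        strict_mono_on {1..k} i \<and> i ` {1..k} \<subseteq> {1..n} \<and>
        strict_mono_on {1..k} j \<and> j ` {1..k} \<subseteq> {1..n} \<and>
        (\<forall>s\<in>{1..k}. x (i s) = y (j s)))"

text \<open>The set below always contains \<open>0\<close> and is bounded by \<open>n\<close>, so the maximum is
  well-defined, and it is \<open>0\<close> if there is no common subsequence of positive length.\<close>

definition LC :: "nat \<Rightarrow> (nat \<Rightarrow> 'b) \<Rightarrow> (nat \<Rightarrow> 'b) \<Rightarrow> nat" where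
  "LC n x y = Max {k. has_common_subseq n x y k}"

end

theory Submission
  imports Defs
begin

text \<open>
  Put \<open>F = LC n\<close>, a function of the \<open>2 * n\<close> independent letters
  \<open>X 1, \<dots>, X n, Y 1, \<dots>, Y n\<close>. Replacing one letter moves \<open>F\<close> by at most \<open>1\<close>: from a common
  subsequence that uses the replaced position, dropping the one matched pair at that position
  leaves a common subsequence of the new words (\<open>has_common_subseq_update\<close>).

  The bound is the Efron--Stein inequality
  \<open>Var F \<le> (1/2) * (\<Sum>i. E (F - F\<^sub>i)\<^sup>2)\<close>, where \<open>F\<^sub>i\<close> has the \<open>i\<close>-th letter resampled, combined with
  \<open>\<bar>F - F\<^sub>i\<bar> \<le> 1\<close> and \<open>F = F\<^sub>i\<close> whenever the resampled letter equals the old one. An independent copy of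
  a letter with law \<open>q\<close> differs from it with probability \<open>1 - (\<Sum>a. (q a)\<^sup>2)\<close>. For \<open>X\<close> this is
  \<open>1 - p\<^sup>2 - (1 - p)\<^sup>2 / m\<close>, for \<open>Y\<close> it is \<open>1 - 1 / m\<close>, and half of \<open>n\<close> times the sum of the two is
  the claim.

  For functions with bounded differences the general Efron--Stein inequality can be bypassed. By the
  law of total variance, splitting off one coordinate writes \<open>Var F\<close> as the mean over the other
  coordinates of the variance in this one, plus the variance of the partial average of \<open>F\<close>
  over it (\<open>pair_variance_le\<close>). Averaging preserves the property that each coordinate moves the value by
  at most \<open>1\<close>, so induction on the number of coordinates applies (\<open>bounded_differences_variance\<close>) and leaves
  the case of one letter (\<open>osc1_variance_bound_finite\<close>). The same splitting, with the whole word \<open>X\<close> as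
  one factor and the whole word \<open>Y\<close> as the other, handles the two sequences without merging them
  into one family.
\<close>

section \<open>Variance under bounded differences\<close>

text \<open>
  The law of total variance, used as a bound. Boundedness of \<open>f\<close> supplies every integrability that
  Fubini's theorem and the expansion of the squares require.
\<close>

lemma pair_variance_le:
  fixes f :: "'a \<times> 'b \<Rightarrow> real"
  assumes M: "prob_space M" and N: "prob_space N"
    and f [measurable]: "f \<in> borel_measurable (M \<Otimes>\<^sub>M N)"
    and B: "\<And>z. z \<in> space (M \<Otimes>\<^sub>M N) \<Longrightarrow> \<bar>f z\<bar> \<le> B"
    and fibre: "\<And>y. y \<in> space N \<Longrightarrow> prob_space.variance M (\<lambda>x. f (x, y)) \<le> a"
    and mean: "prob_space.variance N (\<lambda>y. \<integral>x. f (x, y) \<partial>M) \<le> b"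
  shows "prob_space.variance (M \<Otimes>\<^sub>M N) f \<le> a + b"
proof -
  interpret M: prob_space M by fact
  interpret N: prob_space N by fact
  interpret P: pair_prob_space M N ..
  define g where "g y = (\<integral>x. f (x, y) \<partial>M)" for y
  define h where "h y = (\<integral>x. (f (x, y))\<^sup>2 \<partial>M)" for y
  have [measurable]: "g \<in> borel_measurable N" "h \<in> borel_measurable N"
    unfolding g_def h_def by measurable
  have sqB: "(f z)\<^sup>2 \<le> B\<^sup>2" if "z \<in> space (M \<Otimes>\<^sub>M N)" for z
    using B[OF that] by (metis abs_ge_zero power2_abs power_mono)
  have fx: "integrable M (\<lambda>x. f (x, y))" "integrable M (\<lambda>x. (f (x, y))\<^sup>2)"
    if y: "y \<in> space N" for y
  proof -
    have [measurable]: "(\<lambda>x. f (x, y)) \<in> borel_measurable M"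
      using measurable_compose[OF measurable_Pair2'[OF y] f] .
    show "integrable M (\<lambda>x. f (x, y))"
      by (rule M.integrable_const_bound[where B = B])
         (auto intro!: AE_I2 B simp: space_pair_measure y)
    show "integrable M (\<lambda>x. (f (x, y))\<^sup>2)"
      by (rule M.integrable_const_bound[where B = "B\<^sup>2"])
         (auto intro!: AE_I2 sqB simp: space_pair_measure y)
  qed
  have gB: "\<bar>g y\<bar> \<le> B" and hB: "\<bar>h y\<bar> \<le> B\<^sup>2" if y: "y \<in> space N" for y
  proof -
    have "\<bar>g y\<bar> \<le> (\<integral>x. \<bar>f (x, y)\<bar> \<partial>M)"
      unfolding g_def by simp
    also have "\<dots> \<le> B"
      using fx[OF y] y by (intro M.integral_le_const AE_I2 B) (auto simp: space_pair_measure)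
    finally show "\<bar>g y\<bar> \<le> B" .
    have "h y \<le> B\<^sup>2" unfolding h_def
      using fx[OF y] y by (intro M.integral_le_const AE_I2 sqB) (auto simp: space_pair_measure)
    moreover have "0 \<le> h y" unfolding h_def by simp
    ultimately show "\<bar>h y\<bar> \<le> B\<^sup>2" by simp
  qed
  have ig: "integrable N g"
    using gB by (intro N.integrable_const_bound[where B = B]) auto
  have "(g y)\<^sup>2 \<le> B\<^sup>2" if "y \<in> space N" for y
    using gB[OF that] by (metis abs_ge_zero power2_abs power_mono)
  then have ig2: "integrable N (\<lambda>y. (g y)\<^sup>2)"
    by (intro N.integrable_const_bound[where B = "B\<^sup>2"]) auto
  have ih: "integrable N h"
    using hB by (intro N.integrable_const_bound[where B = "B\<^sup>2"]) auto
  have if1: "integrable (M \<Otimes>\<^sub>M N) f"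
    by (rule P.integrable_const_bound[where B = B]) (auto intro!: AE_I2 B)
  have if2: "integrable (M \<Otimes>\<^sub>M N) (\<lambda>z. (f z)\<^sup>2)"
    by (rule P.integrable_const_bound[where B = "B\<^sup>2"]) (auto intro!: AE_I2 sqB)
  have Ef: "P.expectation f = N.expectation g"
    unfolding g_def using P.integral_snd[of "\<lambda>x y. f (x, y)"] if1 by simp
  have Ef2: "P.expectation (\<lambda>z. (f z)\<^sup>2) = N.expectation h"
    unfolding h_def using P.integral_snd[of "\<lambda>x y. (f (x, y))\<^sup>2"] if2
    by (simp add: case_prod_unfold)
  have "N.expectation (\<lambda>y. h y - (g y)\<^sup>2) \<le> a"
  proof (rule N.integral_le_const)
    show "integrable N (\<lambda>y. h y - (g y)\<^sup>2)"
      using ih ig2 by simp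
    show "AE y in N. h y - (g y)\<^sup>2 \<le> a"
    proof (rule AE_I2)
      fix y assume y: "y \<in> space N"
      show "h y - (g y)\<^sup>2 \<le> a"
        using fibre[OF y] M.variance_eq[OF fx[OF y]] by (simp add: g_def h_def)
    qed
  qed
  moreover have "P.variance f = N.expectation (\<lambda>y. h y - (g y)\<^sup>2) + N.variance g"
    using P.variance_eq[OF if1 if2] N.variance_eq[OF ig ig2] ih ig2 by (simp only: Ef Ef2) simp
  ultimately show ?thesis
    using mean by (simp add: g_def[abs_def])
qed

lemma (in prob_space) abs_expectation_diff_le:
  fixes f g :: "'a \<Rightarrow> real"
  assumes "integrable M f" "integrable M g"
    and "\<And>x. x \<in> space M \<Longrightarrow> \<bar>f x - g x\<bar> \<le> c"
  shows "\<bar>expectation f - expectation g\<bar> \<le> c"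
proof -
  have "\<bar>expectation f - expectation g\<bar> = \<bar>expectation (\<lambda>x. f x - g x)\<bar>"
    using assms by simp
  also have "\<dots> \<le> expectation (\<lambda>x. \<bar>f x - g x\<bar>)"
    by simp
  also have "\<dots> \<le> c"
    using assms by (intro integral_le_const AE_I2) auto
  finally show ?thesis .
qed

text \<open>
  The part of a one-coordinate law that the induction consumes: a bound on the variance of all functions
  whose oscillation is at most \<open>1\<close>. Such bounds add up over independent coordinates.
\<close>

definition osc1_variance_bound :: "'b measure \<Rightarrow> real \<Rightarrow> bool" where
  "osc1_variance_bound N v \<longleftrightarrow>
     (\<forall>h. h \<in> borel_measurable N \<longrightarrow> (\<forall>a\<in>space N. \<forall>b\<in>space N. \<bar>h a - h b\<bar> \<le> 1) \<longrightarrow>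
        prob_space.variance N h \<le> v)"

text \<open>
  In the induction step the coordinate \<open>i\<close> is integrated
  out: for fixed other coordinates \<open>f\<close> has oscillation at most \<open>1\<close> in coordinate \<open>i\<close>, and the
  integral over \<open>i\<close> again has differences bounded by \<open>1\<close>, so the hypothesis applies to it.
\<close>

lemma bounded_differences_variance:
  fixes f :: "('i \<Rightarrow> 'b) \<Rightarrow> real"
  assumes "finite I"
    and "\<And>i. i \<in> I \<Longrightarrow> prob_space (N i)"
    and "\<And>i. i \<in> I \<Longrightarrow> osc1_variance_bound (N i) (v i)"
    and "f \<in> borel_measurable (PiM I N)"
    and "\<And>x. x \<in> space (PiM I N) \<Longrightarrow> \<bar>f x\<bar> \<le> B"
    and "\<And>x i a. x \<in> space (PiM I N) \<Longrightarrow> i \<in> I \<Longrightarrow> a \<in> space (N i) \<Longrightarrow>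
           \<bar>f x - f (x(i := a))\<bar> \<le> 1"
  shows "prob_space.variance (PiM I N) f \<le> (\<Sum>i\<in>I. v i)"
  using assms
proof (induction I arbitrary: f rule: finite_induct)
  case empty
  interpret prob_space "PiM {} N"
    by (rule prob_space_PiM) simp
  have "expectation f = expectation (\<lambda>_. f (\<lambda>_. undefined))"
    by (intro Bochner_Integration.integral_cong refl) (auto simp: space_PiM)
  then have E: "expectation f = f (\<lambda>_. undefined)"
    by (simp add: prob_space)
  have "variance f = expectation (\<lambda>_. 0)"
    by (intro Bochner_Integration.integral_cong refl) (auto simp: space_PiM E)
  then show ?case by simp
next
  case (insert i I)
  note f [measurable] = insert.prems(3)
  note B = insert.prems(4) and diff = insert.prems(5)
  interpret Ni: prob_space "N i" using insert.prems by simp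
  interpret P: prob_space "PiM I N"
    by (rule prob_space_PiM) (use insert.prems in simp)
  define F where "F = (\<lambda>(a, x). f (x(i := a)))"
  have upd [measurable]: "(\<lambda>(a, x). x(i := a)) \<in> N i \<Otimes>\<^sub>M PiM I N \<rightarrow>\<^sub>M PiM (insert i I) N"
    using measurable_compose[OF measurable_pair_swap', OF measurable_add_dim]
    by (simp add: case_prod_unfold)
  have upd_space: "x(i := a) \<in> space (PiM (insert i I) N)"
    if "a \<in> space (N i)" "x \<in> space (PiM I N)" for a x
    using that by (auto simp: space_PiM PiE_iff extensional_def)
  have [measurable]: "F \<in> borel_measurable (N i \<Otimes>\<^sub>M PiM I N)"
    using measurable_compose[OF upd f] by (simp add: F_def case_prod_unfold)
  have distr: "distr (N i \<Otimes>\<^sub>M PiM I N) (PiM (insert i I) N) (\<lambda>(a, x). x(i := a)) = PiM (insert i I) N"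
    by (rule distr_pair_PiM_eq_PiM) (use insert.prems in auto)
  have transfer: "integral\<^sup>L (PiM (insert i I) N) g =
     integral\<^sup>L (N i \<Otimes>\<^sub>M PiM I N) (\<lambda>(a, x). g (x(i := a)))"
    if "g \<in> borel_measurable (PiM (insert i I) N)" for g :: "_ \<Rightarrow> real"
    by (subst distr[symmetric], subst integral_distr[OF upd that]) (simp add: case_prod_unfold)
  have FB: "\<bar>F z\<bar> \<le> B" if "z \<in> space (N i \<Otimes>\<^sub>M PiM I N)" for z
    using that by (auto simp: F_def space_pair_measure intro!: B upd_space)
  have "prob_space.variance (PiM (insert i I) N) f = prob_space.variance (N i \<Otimes>\<^sub>M PiM I N) F"
    by (simp add: transfer F_def case_prod_unfold)
  also have "\<dots> \<le> v i + (\<Sum>j\<in>I. v j)"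
  proof (rule pair_variance_le)
    show "\<bar>F z\<bar> \<le> B" if "z \<in> space (N i \<Otimes>\<^sub>M PiM I N)" for z
      using that by (rule FB)
    show "prob_space.variance (N i) (\<lambda>a. F (a, x)) \<le> v i" if x: "x \<in> space (PiM I N)" for x
    proof -
      have "osc1_variance_bound (N i) (v i)" using insert.prems by simp
      moreover have "(\<lambda>a. F (a, x)) \<in> borel_measurable (N i)"
        using x by simp
      moreover have "\<bar>F (a, x) - F (b, x)\<bar> \<le> 1" if "a \<in> space (N i)" "b \<in> space (N i)" for a b
      proof -
        have "F (a, x) - F (b, x) = f (x(i := a)) - f ((x(i := a))(i := b))"
          by (simp add: F_def)
        then show ?thesis
          using diff[OF upd_space[OF that(1) x] insertI1 that(2)] by (simp only:)
      qed
      ultimately show ?thesis unfolding osc1_variance_bound_def by blast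
    qed
    show "prob_space.variance (PiM I N) (\<lambda>x. \<integral>a. F (a, x) \<partial>N i) \<le> (\<Sum>j\<in>I. v j)"
    proof (rule insert.IH)
      have int: "integrable (N i) (\<lambda>a. F (a, x))" if x: "x \<in> space (PiM I N)" for x
      proof (rule Ni.integrable_const_bound[where B = B])
        show "(\<lambda>a. F (a, x)) \<in> borel_measurable (N i)"
          using x by simp
        show "AE a in N i. norm (F (a, x)) \<le> B"
          by (intro AE_I2) (simp add: FB x space_pair_measure)
      qed
      show "(\<lambda>x. \<integral>a. F (a, x) \<partial>N i) \<in> borel_measurable (PiM I N)"
        by measurable
      show "\<bar>\<integral>a. F (a, x) \<partial>N i\<bar> \<le> B" if x: "x \<in> space (PiM I N)" for x
        using Ni.abs_expectation_diff_le[OF int[OF x], of "\<lambda>_. 0" B] x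
        by (simp add: FB space_pair_measure)
      show "\<bar>(\<integral>a. F (a, x) \<partial>N i) - (\<integral>a. F (a, x(j := b)) \<partial>N i)\<bar> \<le> 1"
        if x: "x \<in> space (PiM I N)" and j: "j \<in> I" and b: "b \<in> space (N j)" for x j b
      proof (rule Ni.abs_expectation_diff_le)
        have x': "x(j := b) \<in> space (PiM I N)"
          using x j b by (auto simp: space_PiM PiE_iff extensional_def)
        show "integrable (N i) (\<lambda>a. F (a, x))" "integrable (N i) (\<lambda>a. F (a, x(j := b)))"
          using int x x' by auto
        have "i \<noteq> j" using j insert.hyps by auto
        show "\<bar>F (a, x) - F (a, x(j := b))\<bar> \<le> 1" if "a \<in> space (N i)" for a
        proof -
          have "F (a, x) - F (a, x(j := b)) = f (x(i := a)) - f ((x(i := a))(j := b))"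
            using \<open>i \<noteq> j\<close> by (simp add: F_def fun_upd_twist)
          then show ?thesis
            using diff[OF upd_space[OF that x] insertI2[OF j] b] by (simp only:)
        qed
      qed
    qed (use insert.prems in auto)
  qed (use Ni.prob_space_axioms P.prob_space_axioms in auto)
  also have "\<dots> = (\<Sum>j\<in>insert i I. v j)"
    using insert.hyps by simp
  finally show ?case .
qed

section \<open>One random letter\<close>

lemma integral_finite_alphabet:
  fixes h :: "'b \<Rightarrow> real"
  assumes "prob_space N" and sets: "sets N = Pow A" and fin: "finite A"
  shows "integral\<^sup>L N h = (\<Sum>a\<in>A. h a * measure N {a})"
proof -
  interpret prob_space N by fact
  have sp: "space N = A" using sets by (metis Pow_iff sets.sets_into_space sets.top subset_antisym Pow_top)
  have "integral\<^sup>L N h = integral\<^sup>L N (\<lambda>x. \<Sum>a\<in>A. h a * indicator {a} x)"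
    by (intro Bochner_Integration.integral_cong refl)
       (auto simp: sp fin indicator_def if_distrib sum.If_cases cong: if_cong)
  also have "\<dots> = (\<Sum>a\<in>A. integral\<^sup>L N (\<lambda>x. h a * indicator {a} x))"
    by (intro Bochner_Integration.integral_sum integrable_mult_right)
       (auto simp: sets sp integrable_indicator_iff less_top[symmetric])
  also have "\<dots> = (\<Sum>a\<in>A. h a * measure N {a})"
    by (intro sum.cong refl) (simp add: sp)
  finally show ?thesis .
qed

text \<open>
  Writing the variance as half the mean squared difference of two independent copies,
  \<open>2 * Var h = (\<Sum>a b. (h a - h b)\<^sup>2 * q a * q b)\<close>, the diagonal terms vanish and the others
  are at most \<open>q a * q b\<close>.
\<close>

lemma osc1_variance_bound_finite:
  assumes "prob_space N" and sets: "sets N = Pow A" and fin: "finite A"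
  shows "osc1_variance_bound N ((1 - (\<Sum>a\<in>A. (measure N {a})\<^sup>2)) / 2)"
  unfolding osc1_variance_bound_def
proof (intro allI impI)
  fix h :: "'a \<Rightarrow> real"
  assume h: "h \<in> borel_measurable N"
    and osc: "\<forall>a\<in>space N. \<forall>b\<in>space N. \<bar>h a - h b\<bar> \<le> 1"
  interpret prob_space N by fact
  have sp: "space N = A" using sets by (metis Pow_iff sets.sets_into_space sets.top subset_antisym Pow_top)
  define q where "q a = measure N {a}" for a
  note E = integral_finite_alphabet[OF assms, folded q_def]
  have q1: "sum q A = 1"
    using E[of "\<lambda>_. 1"] by (simp add: prob_space)
  have var: "variance h = (\<Sum>a\<in>A. (h a)\<^sup>2 * q a) - (\<Sum>a\<in>A. h a * q a)\<^sup>2"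
  proof -
    define e where "e = (\<Sum>a\<in>A. h a * q a)"
    have "variance h = (\<Sum>a\<in>A. (h a - e)\<^sup>2 * q a)"
      by (simp add: E e_def)
    also have "\<dots> = (\<Sum>a\<in>A. (h a)\<^sup>2 * q a - 2 * e * (h a * q a) + e\<^sup>2 * q a)"
      by (intro sum.cong refl) (simp add: power2_eq_square algebra_simps)
    also have "\<dots> = (\<Sum>a\<in>A. (h a)\<^sup>2 * q a) - 2 * e * e + e\<^sup>2 * sum q A"
      by (simp only: sum.distrib sum_subtractf sum_distrib_left[symmetric] e_def[symmetric])
    finally show ?thesis by (simp add: q1 e_def power2_eq_square)
  qed
  have "2 * variance h = (\<Sum>a\<in>A. \<Sum>b\<in>A. (h a - h b)\<^sup>2 * (q a * q b))"
  proof -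
    have "(\<Sum>a\<in>A. \<Sum>b\<in>A. (h a - h b)\<^sup>2 * (q a * q b)) =
        (\<Sum>a\<in>A. \<Sum>b\<in>A. ((h a)\<^sup>2 * q a) * q b + q a * ((h b)\<^sup>2 * q b) - 2 * ((h a * q a) * (h b * q b)))"
      by (intro sum.cong refl) (simp add: power2_eq_square algebra_simps)
    also have "\<dots> = (\<Sum>a\<in>A. (h a)\<^sup>2 * q a) * sum q A + sum q A * (\<Sum>a\<in>A. (h a)\<^sup>2 * q a)
        - 2 * ((\<Sum>a\<in>A. h a * q a) * (\<Sum>a\<in>A. h a * q a))"
      unfolding sum.distrib sum_subtractf sum_product sum_distrib_left[symmetric] ..
    finally show ?thesis using var by (simp only: q1) (simp add: power2_eq_square)
  qed
  also have "\<dots> \<le> (\<Sum>a\<in>A. \<Sum>b\<in>A. q a * q b - (if b = a then (q a)\<^sup>2 else 0))"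
  proof (intro sum_mono)
    fix a b assume "a \<in> A" "b \<in> A"
    then have "(h a - h b)\<^sup>2 \<le> 1"
      using osc by (simp add: sp abs_square_le_1)
    moreover have "0 \<le> q a * q b" by (simp add: q_def)
    ultimately have "(h a - h b)\<^sup>2 * (q a * q b) \<le> q a * q b"
      by (metis mult_left_le_one_le zero_le_power2)
    then show "(h a - h b)\<^sup>2 * (q a * q b) \<le> q a * q b - (if b = a then (q a)\<^sup>2 else 0)"
      by (simp add: power2_eq_square)
  qed
  also have "\<dots> = sum q A * sum q A - (\<Sum>a\<in>A. (q a)\<^sup>2)"
    by (simp add: sum_subtractf sum_product fin)
  finally show "variance h \<le> (1 - (\<Sum>a\<in>A. (measure N {a})\<^sup>2)) / 2"
    by (simp only: q1) (simp add: q_def)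
qed

section \<open>Replacing a letter in a common subsequence\<close>

lemma has_common_subseq_0: "has_common_subseq n x y 0"
  unfolding has_common_subseq_def by (auto simp: strict_mono_on_def)

lemma has_common_subseq_le:
  assumes "has_common_subseq n x y k" shows "k \<le> n"
proof -
  obtain i where "strict_mono_on {1..k} i" "i ` {1..k} \<subseteq> {1..n}"
    using assms by (auto simp: has_common_subseq_def)
  then have "card {1..k} \<le> card {1..n}"
    by (intro card_inj_on_le[of i] strict_mono_on_imp_inj_on) auto
  then show ?thesis by simp
qed

lemma has_common_subseq_commute: "has_common_subseq n x y k \<longleftrightarrow> has_common_subseq n y x k"
  unfolding has_common_subseq_def by metis

lemma LC_commute: "LC n x y = LC n y x"
  unfolding LC_def has_common_subseq_commute[of n x] ..

lemma finite_common: "finite {k. has_common_subseq n x y k}"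
  by (rule finite_subset[of _ "{..n}"]) (auto dest: has_common_subseq_le)

lemma has_common_subseq_LC: "has_common_subseq n x y (LC n x y)"
  using Max_in[OF finite_common, of n x y] has_common_subseq_0 unfolding LC_def by blast

lemma LC_ge: "has_common_subseq n x y k \<Longrightarrow> k \<le> LC n x y"
  unfolding LC_def by (rule Max_ge[OF finite_common]) simp

lemma LC_le: "LC n x y \<le> n"
  by (rule has_common_subseq_le[OF has_common_subseq_LC])

lemma LC_cong:
  assumes "\<And>k. k \<in> {1..n} \<Longrightarrow> x k = x' k" "\<And>k. k \<in> {1..n} \<Longrightarrow> y k = y' k"
  shows "LC n x y = LC n x' y'"
proof -
  have "has_common_subseq n x y k \<longleftrightarrow> has_common_subseq n x' y' k" for k
  proof -
    have "x (i s) = y (j s) \<longleftrightarrow> x' (i s) = y' (j s)"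
      if "i ` {1..k} \<subseteq> {1..n}" "j ` {1..k} \<subseteq> {1..n}" "s \<in> {1..k}" for i j s
      using that assms by (metis image_subset_iff)
    then show ?thesis
      unfolding has_common_subseq_def by (metis (no_types, lifting))
  qed
  then show ?thesis by (simp add: LC_def)
qed

text \<open>
  The positions used in \<open>x\<close> are distinct, so at most one of the \<open>Suc k\<close> matched pairs involves
  position \<open>l\<close>; without it the remaining \<open>k\<close> pairs do not see the new letter.
\<close>

lemma has_common_subseq_update:
  assumes "has_common_subseq n x y (Suc k)"
  shows "has_common_subseq n (x(l := a)) y k"
proof -
  obtain i j where i: "strict_mono_on {1..Suc k} i" "i ` {1..Suc k} \<subseteq> {1..n}"
    and j: "strict_mono_on {1..Suc k} j" "j ` {1..Suc k} \<subseteq> {1..n}"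
    and eq: "\<And>s. s \<in> {1..Suc k} \<Longrightarrow> x (i s) = y (j s)"
    using assms by (auto simp: has_common_subseq_def)
  \<comment> \<open>The pair to drop; if position \<open>l\<close> is not used, any index will do.\<close>
  obtain t where t: "t \<in> {1..Suc k}" "\<And>s. s \<in> {1..Suc k} \<Longrightarrow> i s = l \<Longrightarrow> s = t"
  proof (cases "\<exists>t\<in>{1..Suc k}. i t = l")
    case True
    then show ?thesis
      using that strict_mono_on_imp_inj_on[OF i(1)] by (metis inj_onD)
  next
    case False
    then show ?thesis using that[of "Suc k"] by auto
  qed
  \<comment> \<open>The increasing enumeration of \<open>{1..Suc k} - {t}\<close>.\<close>
  define u where "u s = (if s < t then s else Suc s)" for s
  have u: "u s \<in> {1..Suc k}" "u s \<noteq> t" if "s \<in> {1..k}" for s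
    using that t(1) by (auto simp: u_def)
  have um: "u s < u s'" if "s < s'" for s s'
    using that by (auto simp: u_def)
  have "strict_mono_on {1..k} (i \<circ> u)" "strict_mono_on {1..k} (j \<circ> u)"
    using i(1) j(1) u um unfolding strict_mono_on_def by (simp_all add: o_def)
  moreover have "(i \<circ> u) ` {1..k} \<subseteq> {1..n}" "(j \<circ> u) ` {1..k} \<subseteq> {1..n}"
    using i(2) j(2) u(1) by (auto simp: image_subset_iff)
  moreover have "(x(l := a)) ((i \<circ> u) s) = y ((j \<circ> u) s)" if "s \<in> {1..k}" for s
    using eq[OF u(1)[OF that]] t(2)[OF u(1)[OF that]] u(2)[OF that] by auto
  ultimately show ?thesis unfolding has_common_subseq_def by blast
qed

lemma LC_le_update: "LC n x y \<le> Suc (LC n (x(l := a)) y)"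
proof (cases "LC n x y")
  case (Suc k)
  then show ?thesis
    using has_common_subseq_LC[of n x y] by (simp add: LC_ge has_common_subseq_update)
qed simp

lemma LC_update_left: "\<bar>real (LC n x y) - real (LC n (x(l := a)) y)\<bar> \<le> 1"
proof -
  have "LC n (x(l := a)) y \<le> Suc (LC n x y)"
    using LC_le_update[of n "x(l := a)" y l "x l"] by simp
  then show ?thesis using LC_le_update[of n x y l a] by linarith
qed

lemma LC_update_right: "\<bar>real (LC n x y) - real (LC n x (y(l := a)))\<bar> \<le> 1"
  using LC_update_left[of n y x l a] by (simp add: LC_commute)

section \<open>The joint law of the two words\<close>

lemma (in prob_space) distr_iid_seq:
  assumes "iid_seq N Z" and "0 < n"
  shows "distr M (PiM {1..n} (\<lambda>_. N)) (\<lambda>\<omega>. \<lambda>k\<in>{1..n}. Z k \<omega>) = PiM {1..n} (\<lambda>_. distr M N (Z 1))"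
proof -
  have ind: "indep_vars (\<lambda>_. N) Z {1..n}"
    by (rule indep_vars_subset[where I = "{1..}"]) (use assms(1) in \<open>auto simp: iid_seq_def\<close>)
  then have "distr M (PiM {1..n} (\<lambda>_. N)) (\<lambda>\<omega>. \<lambda>k\<in>{1..n}. Z k \<omega>) = PiM {1..n} (\<lambda>k. distr M N (Z k))"
    by (subst (asm) indep_vars_iff_distr_eq_PiM') (use \<open>0 < n\<close> ind in \<open>auto simp: indep_vars_def\<close>)
  also have "\<dots> = PiM {1..n} (\<lambda>_. distr M N (Z 1))"
  proof (rule PiM_cong)
    have "\<forall>k\<ge>1. distr M N (Z k) = distr M N (Z 1)"
      using assms(1) unfolding iid_seq_def by (rule conjunct2)
    then show "distr M N (Z k) = distr M N (Z 1)" if "k \<in> {1..n}" for k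
      using that by (metis atLeastAtMost_iff)
  qed simp
  finally show ?thesis .
qed

lemma (in prob_space) distr_indep_iid_seqs:
  assumes Z: "iid_seq N Z" and W: "iid_seq N W" and ZW: "indep_seqs N Z W" and n: "0 < n"
  shows "distr M (PiM {1..n} (\<lambda>_. N) \<Otimes>\<^sub>M PiM {1..n} (\<lambda>_. N))
      (\<lambda>\<omega>. (\<lambda>k\<in>{1..n}. Z k \<omega>, \<lambda>k\<in>{1..n}. W k \<omega>)) =
     PiM {1..n} (\<lambda>_. distr M N (Z 1)) \<Otimes>\<^sub>M PiM {1..n} (\<lambda>_. distr M N (W 1))"
proof -
  let ?r = "\<lambda>x. restrict x {1..n}"
  let ?P = "PiM {1..n} (\<lambda>_. N)"
  have r: "?r \<in> PiM {1..} (\<lambda>_. N) \<rightarrow>\<^sub>M ?P"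
    by (rule measurable_restrict_subset) auto
  have "indep_var ?P (?r \<circ> (\<lambda>\<omega>. \<lambda>k\<in>{1..}. Z k \<omega>)) ?P (?r \<circ> (\<lambda>\<omega>. \<lambda>k\<in>{1..}. W k \<omega>))"
    using ZW unfolding indep_seqs_def by (rule indep_var_compose[OF _ r r])
  moreover have "?r \<circ> (\<lambda>\<omega>. \<lambda>k\<in>{1..}. V k \<omega>) = (\<lambda>\<omega>. \<lambda>k\<in>{1..n}. V k \<omega>)" for V :: "nat \<Rightarrow> 'a \<Rightarrow> 'b"
    by (auto simp: fun_eq_iff)
  ultimately have "indep_var ?P (\<lambda>\<omega>. \<lambda>k\<in>{1..n}. Z k \<omega>) ?P (\<lambda>\<omega>. \<lambda>k\<in>{1..n}. W k \<omega>)"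
    by simp
  then show ?thesis
    unfolding indep_var_distribution_eq distr_iid_seq[OF Z n] distr_iid_seq[OF W n] by simp
qed

section \<open>The variance bound\<close>

text \<open>
  The bounded differences inequality is applied twice: to the word \<open>x\<close> for fixed \<open>y\<close>, and to the word
  \<open>y\<close> for the average of \<open>LC n x y\<close> over \<open>x\<close>, which inherits the differences bounded by \<open>1\<close>.
  There are only finitely many words, so measurability is automatic.
\<close>

lemma variance_LC_product:
  fixes P Q :: "'b measure"
  assumes P: "prob_space P" "sets P = Pow A" and Q: "prob_space Q" "sets Q = Pow A"
    and A: "finite A"
  shows "prob_space.variance (PiM {1..n} (\<lambda>_. P) \<Otimes>\<^sub>M PiM {1..n} (\<lambda>_. Q)) (\<lambda>(x, y). real (LC n x y))
     \<le> real n / 2 * (2 - (\<Sum>a\<in>A. (measure P {a})\<^sup>2) - (\<Sum>a\<in>A. (measure Q {a})\<^sup>2))"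
proof -
  interpret P: prob_space P by fact
  interpret Q: prob_space Q by fact
  let ?P = "PiM {1..n} (\<lambda>_. P)" and ?Q = "PiM {1..n} (\<lambda>_. Q)"
  let ?a = "(1 - (\<Sum>a\<in>A. (measure P {a})\<^sup>2)) / 2" and ?b = "(1 - (\<Sum>a\<in>A. (measure Q {a})\<^sup>2)) / 2"
  interpret PP: prob_space ?P by (rule prob_space_PiM) (rule P)
  interpret QQ: prob_space ?Q by (rule prob_space_PiM) (rule Q)
  have words: "sets (PiM {1..n} (\<lambda>_. R)) = sets (count_space ({1..n} \<rightarrow>\<^sub>E A))"
    if "sets R = Pow A" for R :: "'b measure"
  proof -
    have "sets (PiM {1..n} (\<lambda>_. R)) = sets (PiM {1..n} (\<lambda>_. count_space A))"
      using that by (intro sets_PiM_cong) auto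
    then show ?thesis
      using A by (simp add: count_space_PiM_finite countable_finite)
  qed
  have "sets (?P \<Otimes>\<^sub>M ?Q) = sets (count_space ({1..n} \<rightarrow>\<^sub>E A) \<Otimes>\<^sub>M count_space ({1..n} \<rightarrow>\<^sub>E A))"
    by (intro sets_pair_measure_cong words P Q)
  also have "\<dots> = sets (count_space (({1..n} \<rightarrow>\<^sub>E A) \<times> ({1..n} \<rightarrow>\<^sub>E A)))"
    using A by (subst pair_measure_countable) (auto intro!: countable_finite finite_PiE)
  finally have pairs: "sets (?P \<Otimes>\<^sub>M ?Q) = \<dots>" .
  have meas: "f \<in> borel_measurable (?P \<Otimes>\<^sub>M ?Q)" for f :: "_ \<Rightarrow> real"
    unfolding measurable_cong_sets[OF pairs refl] by simp
  have measP: "f \<in> borel_measurable ?P" and measQ: "f \<in> borel_measurable ?Q" for f :: "_ \<Rightarrow> real"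
    unfolding measurable_cong_sets[OF words[OF P(2)] refl] measurable_cong_sets[OF words[OF Q(2)] refl]
    by simp_all
  have int: "integrable ?P (\<lambda>x. real (LC n x y))" for y
    by (rule PP.integrable_const_bound[where B = "real n", OF _ measP]) (simp add: LC_le)
  have "prob_space.variance (?P \<Otimes>\<^sub>M ?Q) (\<lambda>(x, y). real (LC n x y)) \<le> (\<Sum>i\<in>{1..n}. ?a) + (\<Sum>i\<in>{1..n}. ?b)"
  proof (rule pair_variance_le)
    show "\<bar>case z of (x, y) \<Rightarrow> real (LC n x y)\<bar> \<le> real n" for z :: "(nat \<Rightarrow> 'b) \<times> (nat \<Rightarrow> 'b)"
      by (simp add: LC_le split: prod.split)
    show "PP.variance (\<lambda>x. case (x, y) of (x, y) \<Rightarrow> real (LC n x y)) \<le> (\<Sum>i\<in>{1..n}. ?a)" for y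
      unfolding prod.case
      by (rule bounded_differences_variance[where B = "real n"])
         (simp_all add: LC_le LC_update_left measP P osc1_variance_bound_finite[OF P A] del: One_nat_def)
    show "QQ.variance (\<lambda>y. \<integral>x. (case (x, y) of (x, y) \<Rightarrow> real (LC n x y)) \<partial>?P) \<le> (\<Sum>i\<in>{1..n}. ?b)"
      unfolding prod.case
    proof (rule bounded_differences_variance[where B = "real n"])
      show "\<bar>\<integral>x. real (LC n x y) \<partial>?P\<bar> \<le> real n" for y
        using PP.abs_expectation_diff_le[OF int, of "\<lambda>_. 0" y "real n"] by (simp add: LC_le)
      show "\<bar>(\<integral>x. real (LC n x y) \<partial>?P) - (\<integral>x. real (LC n x (y(i := a))) \<partial>?P)\<bar> \<le> 1" for y i a
        by (rule PP.abs_expectation_diff_le[OF int int LC_update_right])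
    qed (simp_all add: measQ Q osc1_variance_bound_finite[OF Q A] del: One_nat_def)
  qed (fact meas PP.prob_space_axioms QQ.prob_space_axioms)+
  also have "\<dots> = real n / 2 * (2 - (\<Sum>a\<in>A. (measure P {a})\<^sup>2) - (\<Sum>a\<in>A. (measure Q {a})\<^sup>2))"
    by (simp add: field_simps)
  finally show ?thesis .
qed

theorem mainTheorem2:
  fixes M :: "'w measure"
    and m :: nat and p :: real
    and \<alpha> :: "nat \<Rightarrow> 'a"
    and A :: "'a set"
    and X Y :: "nat \<Rightarrow> 'w \<Rightarrow> 'a"
    and n :: nat
  assumes "prob_space M"
    and "m \<ge> 1"
    and "0 < p" and "p < 1"
    and "inj_on \<alpha> {1..m + 1}"
    and "A = \<alpha> ` {1..m + 1}"
    and "prob_space.iid_seq M (count_space A) X"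
    and "\<And>i. i \<in> {1..m} \<Longrightarrow> \<P>(\<omega> in M. X 1 \<omega> = \<alpha> i) = (1 - p) / real m"
    and "\<P>(\<omega> in M. X 1 \<omega> = \<alpha> (m + 1)) = p"
    and "prob_space.iid_seq M (count_space A) Y"
    and "\<And>i. i \<in> {1..m} \<Longrightarrow> \<P>(\<omega> in M. Y 1 \<omega> = \<alpha> i) = 1 / real m"
    and "prob_space.indep_seqs M (count_space A) X Y"
  shows "prob_space.variance M (\<lambda>\<omega>. real (LC n (\<lambda>k. X k \<omega>) (\<lambda>k. Y k \<omega>)))
           \<le> real n / 2 * (2 - p\<^sup>2 - (1 + (1 - p)\<^sup>2) / real m)"
proof (cases "n = 0")
  case True
  interpret prob_space M by fact
  have "LC n x y = 0" for x y :: "nat \<Rightarrow> 'a"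
    using LC_le[of n x y] True by simp
  then show ?thesis using True by simp
next
  case False
  interpret prob_space M by fact
  let ?N = "count_space A"
  let ?PX = "distr M ?N (X 1)" and ?PY = "distr M ?N (Y 1)"
  let ?W = "PiM {1..n} (\<lambda>_. ?N)"
  let ?XY = "\<lambda>\<omega>. (\<lambda>k\<in>{1..n}. X k \<omega>, \<lambda>k\<in>{1..n}. Y k \<omega>)"
  have A: "finite A" using assms by simp
  have rv: "X k \<in> M \<rightarrow>\<^sub>M ?N" "Y k \<in> M \<rightarrow>\<^sub>M ?N" if "k \<ge> 1" for k
    using assms(7,10) that by (auto simp: iid_seq_def indep_vars_def)
  have XY: "?XY \<in> M \<rightarrow>\<^sub>M ?W \<Otimes>\<^sub>M ?W"
    using rv by (intro measurable_Pair measurable_restrict) auto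
  have meas: "f \<in> borel_measurable (?W \<Otimes>\<^sub>M ?W)" for f :: "_ \<Rightarrow> real"
    using A by (simp add: count_space_PiM_finite countable_finite pair_measure_countable finite_PiE)
  note law = distr_indep_iid_seqs[OF assms(7,10,12), of n]
  have LCeq: "LC n (\<lambda>k. X k \<omega>) (\<lambda>k. Y k \<omega>) = (case ?XY \<omega> of (x, y) \<Rightarrow> LC n x y)" for \<omega>
    by (auto intro: LC_cong)
  have transfer: "expectation (\<lambda>\<omega>. g (?XY \<omega>)) =
      integral\<^sup>L (PiM {1..n} (\<lambda>_. ?PX) \<Otimes>\<^sub>M PiM {1..n} (\<lambda>_. ?PY)) g" for g :: "_ \<Rightarrow> real"
    using False by (subst law[symmetric]) (simp_all only: integral_distr[OF XY meas] neq0_conv)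
  define L where "L = (\<lambda>(x :: nat \<Rightarrow> 'a, y). real (LC n x y))"
  have L: "real (LC n (\<lambda>k. X k \<omega>) (\<lambda>k. Y k \<omega>)) = L (?XY \<omega>)" for \<omega>
    by (simp add: LCeq L_def)
  have "variance (\<lambda>\<omega>. real (LC n (\<lambda>k. X k \<omega>) (\<lambda>k. Y k \<omega>))) =
     prob_space.variance (PiM {1..n} (\<lambda>_. ?PX) \<Otimes>\<^sub>M PiM {1..n} (\<lambda>_. ?PY)) L"
    unfolding L transfer[of L]
    by (rule transfer)
  also have "\<dots> \<le> real n / 2 * (2 - (\<Sum>a\<in>A. (measure ?PX {a})\<^sup>2) - (\<Sum>a\<in>A. (measure ?PY {a})\<^sup>2))"
    unfolding L_def
    by (rule variance_LC_product) (use rv A in \<open>auto intro!: prob_space_distr\<close>)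
  also have "\<dots> \<le> real n / 2 * (2 - p\<^sup>2 - (1 + (1 - p)\<^sup>2) / real m)"
  proof (rule mult_left_mono)
    have sumA: "(\<Sum>a\<in>A. g a) = g (\<alpha> (m + 1)) + (\<Sum>i=1..m. g (\<alpha> i))" for g :: "'a \<Rightarrow> real"
      using assms(5) by (simp add: assms(6) sum.reindex)
    have letter: "measure ?PX {\<alpha> i} = \<P>(\<omega> in M. X 1 \<omega> = \<alpha> i)"
      "measure ?PY {\<alpha> i} = \<P>(\<omega> in M. Y 1 \<omega> = \<alpha> i)" if "i \<in> {1..m+1}" for i
      using that rv[of 1] by (auto simp: measure_distr assms(6) vimage_def intro!: arg_cong[where f = prob])
    have "(\<Sum>a\<in>A. (measure ?PX {a})\<^sup>2) = p\<^sup>2 + (1 - p)\<^sup>2 / real m"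
      using assms(2) by (simp add: sumA letter assms(8,9) power_divide power2_eq_square[of "real m"] del: One_nat_def)
    moreover have "(\<Sum>a\<in>A. (measure ?PY {a})\<^sup>2) \<ge> 1 / real m"
      using assms(2) by (simp add: sumA letter assms(11) power_divide power2_eq_square[of "real m"] del: One_nat_def)
    ultimately show "2 - (\<Sum>a\<in>A. (measure ?PX {a})\<^sup>2) - (\<Sum>a\<in>A. (measure ?PY {a})\<^sup>2)
       \<le> 2 - p\<^sup>2 - (1 + (1 - p)\<^sup>2) / real m"
      by (simp add: add_divide_distrib)
  qed simp
  finally show ?thesis .
qed

end
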